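(* The following terms are derivable in the system $\mathcal{I}_s$: $\forall x, y : \mathrm{Nat} .\, (\mathfrak{s} x =_\mathrm{Nat} \mathfrak{s} y) \supset (x =_\mathrm{Nat} y)$; $\forall x : \mathrm{Nat} .\, \neg (\mathfrak{s} x =_\mathrm{Nat} 0)$; $\forall x : \mathrm{Nat} .\, (x + 0 =_\mathrm{Nat} x)$; $\forall x, y : \mathrm{Nat} .\, (x + \mathfrak{s} y =_\mathrm{Nat} \mathfrak{s} (x + y))$; $\forall x : \mathrm{Nat} .\, (x \cdot 0 =_\mathrm{Nat} 0)$; $\forall x, y : \mathrm{Nat} .\, (x \cdot (\mathfrak{s} y) =_\mathrm{Nat} (x \cdot y) + x)$.
   Context: $\mathcal{I}_s$ is an illative system of classical higher-order logic with subtyping and basic inductive types, built on the untyped $\lambda$-calculus. Its terms are generated from variables, constants, $\mathrm{Type}$, $\mathrm{Prop}$, basic inductive types with constructors $c_i^\iota$, destructors $d_{i,j}^\iota$ and tests $o_i^\iota$, $\lambda$-abstraction and application, plus primitive constants $\mathrm{Is}, \mathrm{Subtype}, \mathrm{Fun}, \forall, \vee, \bot, \epsilon, \mathrm{Eq}, \mathrm{Cond}$. Abbreviations: $t:\alpha\equiv\mathrm{Is}\,t\,\alpha$; $\alpha\to\beta\equiv\mathrm{Fun}\,\alpha\,\beta$; $\forall x:\alpha.\varphi\equiv\forall\,\alpha\,(\lambda x.\varphi)$; $\varphi\supset\psi\equiv\forall x:(\mathrm{Subtype}\,\mathrm{Prop}\,(\lambda y.\varphi)).\psi$ ($x,y$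 fresh); $\neg\varphi\equiv\varphi\supset\bot$; $t_1=t_2$ denotes $\mathrm{Eq}\,t_1\,t_2$. The system has natural-deduction rules for $\forall,\vee,\exists,\wedge,\supset$ (where $\forall$-introduction requires $\alpha:\mathrm{Type}$ and implication introduction requires $\varphi:\mathrm{Prop}$), typing rules for $\to$, subtypes, quantifiers and disjunction, the excluded-middle axiom $\forall p:\mathrm{Prop}.p\vee\neg p$, $\beta$-equality and congruence rules for $\mathrm{Eq}$ (with: from $\varphi$ and $\varphi=\varphi'$ infer $\varphi'$), rules making $\mathrm{Cond}\,\varphi\,t_1\,t_2$ equal to $t_1$ if $\varphi$ and to $t_2$ if $\neg\varphi$, axioms $o_i^\iota(c_i^\iota t_1\ldots t_{n_i})$, $\neg o_i^\iota(c_j^\iota\ldots)$ for $i\neq j$, $d_{i,k}^\iota(c_i^\iota t_1\ldots t_{n_i})=t_k$, and an induction rule and constructor-typing rule for each inductive type. For natural numbers $\mathrm{Nat}\equiv\mu(\langle\rangle,\langle\star\rangle)$, with $0\equiv c_1^\mathrm{Nat}$, zero-test $\mathfrak{0}\equiv o_1^\mathrm{Nat}$, successor $\mathfrak{s}\equiv c_2^\mathrm{Nat}$ and predecessor $\mathfrak{p}\equiv\lambda x.\mathrm{Cond}\,(\mathfrak{0}x)\,0\,(d_{2,1}^\mathrm{Nat}x)$, these rules become: induction (from $\Gamma\vdash t\,0$ and $\Gamma,x:\mathrm{Nat},t\,x\vdash t(\mathfrak{s}x)$, $x\notin FV(\Gamma,t)$, infer $\Gamma\vdash\forall x:\mathrm{Nat}.\,t\,x$,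 with no restriction on $t$), $0:\mathrm{Nat}$, and from $t:\mathrm{Nat}$ infer $\mathfrak{s}t:\mathrm{Nat}$. Using the untyped fixpoint, a recursor $R$ is defined with $R=\lambda g h x y.\mathrm{Cond}\,(\mathfrak{0}y)\,(g x)\,(h\,x\,(\mathfrak{p}y)\,(R\,g\,h\,x\,(\mathfrak{p}y)))$, and $x+y=R(\lambda x.x)(\lambda xyz.\mathfrak{s}z)xy$, $x\cdot y=R(\lambda x.0)(\lambda xyz.x+z)xy$. $t_1=_\alpha t_2$ is Leibniz equality $\forall p:\alpha\to\mathrm{Prop}.\,p\,t_1\supset p\,t_2$. *)

theory Defs
  imports Main
begin

text \<open>
  Basic inductive types \<open>\<mu>(s\<^sub>1, \<dots>, s\<^sub>m)\<close> with \<open>m \<ge> 1\<close>: one signature per constructor, the first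
  one being a separate argument so that the list of signatures is not empty. In a signature,
  \<open>None\<close> is the recursive occurrence \<open>\<star>\<close> and \<open>Some \<iota>'\<close> a previously formed type.
\<close>

datatype ind = Mu "ind option list" "ind option list list"

fun sigs :: "ind \<Rightarrow> ind option list list" where
  "sigs (Mu s ss) = s # ss"

text \<open>The type \<open>\<iota>*\<close> of an argument of a constructor of \<open>\<iota>\<close>.\<close>

definition arg_type :: "ind \<Rightarrow> ind option \<Rightarrow> ind" where
  "arg_type \<iota> a = (case a of None \<Rightarrow> \<iota> | Some \<iota>' \<Rightarrow> \<iota>')"

text \<open>
  Terms modulo \<open>\<alpha>\<close>-equivalence, in de Bruijn notation; the constants \<open>\<Sigma>\<close> are the elements of \<open>'c\<close>.
  Constructors \<open>c\<^sub>i\<close>, destructors \<open>d\<^sub>i\<^sub>,\<^sub>j\<close> and tests \<open>o\<^sub>i\<close> are numbered from 0. Symbols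
  whose indices are out of range behave as additional uninterpreted constants: no rule below
  mentions them.
\<close>

datatype 'c trm =
    Var nat
  | Const 'c
  | Type
  | Prop
  | Ind ind
  | Constr ind nat
  | Destr ind nat nat
  | Test ind nat
  | Lam "'c trm"
  | App "'c trm" "'c trm"  (infixl \<open>\<cdot>\<close> 100)
  | Is
  | Subtype
  | Fun
  | Forall
  | Or
  | Bot
  | Eps
  | Eq
  | Cond

primrec lift :: "nat \<Rightarrow> 'c trm \<Rightarrow> 'c trm" where
  "lift k (Var i) = Var (if i < k then i else Suc i)"
| "lift k (Const c) = Const c"
| "lift k Type = Type"
| "lift k Prop = Prop"
| "lift k (Ind \<iota>) = Ind \<iota>"
| "lift k (Constr \<iota> i) = Constr \<iota> i"
| "lift k (Destr \<iota> i j) = Destr \<iota> i j"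
| "lift k (Test \<iota> i) = Test \<iota> i"
| "lift k (Lam t) = Lam (lift (Suc k) t)"
| "lift k (s \<cdot> t) = lift k s \<cdot> lift k t"
| "lift k Is = Is"
| "lift k Subtype = Subtype"
| "lift k Fun = Fun"
| "lift k Forall = Forall"
| "lift k Or = Or"
| "lift k Bot = Bot"
| "lift k Eps = Eps"
| "lift k Eq = Eq"
| "lift k Cond = Cond"

text \<open>\<open>subst k s t\<close> replaces variable \<open>k\<close> of \<open>t\<close> by \<open>s\<close> and lowers the variables above \<open>k\<close>.\<close>

primrec subst :: "nat \<Rightarrow> 'c trm \<Rightarrow> 'c trm \<Rightarrow> 'c trm" where
  "subst k s (Var i) = (if i < k then Var i else if i = k then s else Var (i - 1))"
| "subst k s (Const c) = Const c"
| "subst k s Type = Type"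
| "subst k s Prop = Prop"
| "subst k s (Ind \<iota>) = Ind \<iota>"
| "subst k s (Constr \<iota> i) = Constr \<iota> i"
| "subst k s (Destr \<iota> i j) = Destr \<iota> i j"
| "subst k s (Test \<iota> i) = Test \<iota> i"
| "subst k s (Lam t) = Lam (subst (Suc k) (lift 0 s) t)"
| "subst k s (t \<cdot> u) = subst k s t \<cdot> subst k s u"
| "subst k s Is = Is"
| "subst k s Subtype = Subtype"
| "subst k s Fun = Fun"
| "subst k s Forall = Forall"
| "subst k s Or = Or"
| "subst k s Bot = Bot"
| "subst k s Eps = Eps"
| "subst k s Eq = Eq"
| "subst k s Cond = Cond"

definition apps :: "'c trm \<Rightarrow> 'c trm list \<Rightarrow> 'c trm" where
  "apps t ts = foldl (\<cdot>) t ts"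

definition is_type :: "'c trm \<Rightarrow> 'c trm \<Rightarrow> 'c trm"  (infix \<open>\<^bold>:\<close> 70) where
  "(t \<^bold>: \<alpha>) = Is \<cdot> t \<cdot> \<alpha>"

definition fun_type :: "'c trm \<Rightarrow> 'c trm \<Rightarrow> 'c trm"  (infixr \<open>\<^bold>\<rightarrow>\<close> 75) where
  "(\<alpha> \<^bold>\<rightarrow> \<beta>) = Fun \<cdot> \<alpha> \<cdot> \<beta>"

definition equal :: "'c trm \<Rightarrow> 'c trm \<Rightarrow> 'c trm"  (infix \<open>\<^bold>=\<close> 70) where
  "(s \<^bold>= t) = Eq \<cdot> s \<cdot> t"

definition lor :: "'c trm \<Rightarrow> 'c trm \<Rightarrow> 'c trm"  (infixr \<open>\<^bold>\<or>\<close> 62) where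
  "(\<phi> \<^bold>\<or> \<psi>) = Or \<cdot> \<phi> \<cdot> \<psi>"

text \<open>In the binding forms \<open>\<forall>x:\<alpha>. \<phi>\<close>, \<open>\<exists>x:\<alpha>. \<phi>\<close> and \<open>{x:\<alpha> | \<phi>}\<close>, \<open>x\<close> is variable 0 of \<open>\<phi>\<close>.\<close>

definition all :: "'c trm \<Rightarrow> 'c trm \<Rightarrow> 'c trm" where
  "all \<alpha> \<phi> = Forall \<cdot> \<alpha> \<cdot> Lam \<phi>"

definition subtype :: "'c trm \<Rightarrow> 'c trm \<Rightarrow> 'c trm" where
  "subtype \<alpha> \<phi> = Subtype \<cdot> \<alpha> \<cdot> Lam \<phi>"

definition imp :: "'c trm \<Rightarrow> 'c trm \<Rightarrow> 'c trm"  (infixr \<open>\<^bold>\<supset>\<close> 61) where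
  "(\<phi> \<^bold>\<supset> \<psi>) = all (subtype Prop (lift 0 \<phi>)) (lift 0 \<psi>)"

definition neg :: "'c trm \<Rightarrow> 'c trm"  (\<open>\<^bold>\<not> _\<close> [66] 66) where
  "\<^bold>\<not> \<phi> = (\<phi> \<^bold>\<supset> Bot)"

definition land :: "'c trm \<Rightarrow> 'c trm \<Rightarrow> 'c trm"  (infixr \<open>\<^bold>\<and>\<close> 64) where
  "(\<phi> \<^bold>\<and> \<psi>) = \<^bold>\<not> (\<^bold>\<not> \<phi> \<^bold>\<or> \<^bold>\<not> \<psi>)"

definition ex :: "'c trm \<Rightarrow> 'c trm \<Rightarrow> 'c trm" where
  "ex \<alpha> \<phi> = \<^bold>\<not> all \<alpha> (\<^bold>\<not> \<phi>)"

definition leibniz :: "'c trm \<Rightarrow> 'c trm \<Rightarrow> 'c trm \<Rightarrow> 'c trm"  (\<open>_ \<^bold>=\<^bsub>_\<^esub> _\<close> [71, 0, 71] 70) where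
  "(s \<^bold>=\<^bsub>\<alpha>\<^esub> t) = all (\<alpha> \<^bold>\<rightarrow> Prop) (Var 0 \<cdot> lift 0 s \<^bold>\<supset> Var 0 \<cdot> lift 0 t)"

text \<open>
  Premises with a context \<open>\<Gamma>, x : \<alpha>\<close> where \<open>x \<notin> FV(\<Gamma>, \<alpha>, \<dots>)\<close>: the fresh \<open>x\<close> is variable 0
  and all other terms are lifted.
\<close>

definition up :: "'c trm set \<Rightarrow> 'c trm set" where
  "up \<Gamma> = lift 0 ` \<Gamma>"

definition extend :: "'c trm \<Rightarrow> 'c trm set \<Rightarrow> 'c trm set" where
  "extend \<alpha> \<Gamma> = insert (Var 0 \<^bold>: lift 0 \<alpha>) (up \<Gamma>)"

text \<open>
  The premise of the induction rule for constructor \<open>c\<^sub>i\<close> of arity \<open>n\<close> has \<open>n\<close> fresh variables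
  \<open>x\<^sub>0, \<dots>, x\<^bsub>n-1\<^esub>\<close>, with \<open>x\<^sub>j\<close> represented by variable \<open>n - 1 - j\<close>.
\<close>

definition ind_var :: "ind \<Rightarrow> nat \<Rightarrow> nat \<Rightarrow> 'c trm" where
  "ind_var \<iota> i j = Var (length (sigs \<iota> ! i) - 1 - j)"

definition ind_shift :: "ind \<Rightarrow> nat \<Rightarrow> 'c trm \<Rightarrow> 'c trm" where
  "ind_shift \<iota> i = lift 0 ^^ length (sigs \<iota> ! i)"

definition ind_context :: "ind \<Rightarrow> nat \<Rightarrow> 'c trm \<Rightarrow> 'c trm set \<Rightarrow> 'c trm set" where
  "ind_context \<iota> i t \<Gamma> =
     ind_shift \<iota> i ` \<Gamma>
     \<union> {ind_var \<iota> i j \<^bold>: Ind (arg_type \<iota> (sigs \<iota> ! i ! j)) |j. j < length (sigs \<iota> ! i)}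
     \<union> {ind_shift \<iota> i t \<cdot> ind_var \<iota> i j |j. j < length (sigs \<iota> ! i) \<and> sigs \<iota> ! i ! j = None}"

definition ind_goal :: "ind \<Rightarrow> nat \<Rightarrow> 'c trm \<Rightarrow> 'c trm" where
  "ind_goal \<iota> i t =
     ind_shift \<iota> i t \<cdot> apps (Constr \<iota> i) (map (ind_var \<iota> i) [0..<length (sigs \<iota> ! i)])"

text \<open>
  Derivability. No rule passes from a finite context in its conclusion to an infinite one in a
  premise, so on finite contexts it is immaterial that arbitrary sets are admitted.
\<close>

inductive derives :: "'c trm set \<Rightarrow> 'c trm \<Rightarrow> bool"  (infix \<open>\<turnstile>\<close> 50) where
  hyp: "\<phi> \<in> \<Gamma> \<Longrightarrow> \<Gamma> \<turnstile> \<phi>"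
| prop_type: "\<Gamma> \<turnstile> Prop \<^bold>: Type"
| ind_type: "\<Gamma> \<turnstile> Ind \<iota> \<^bold>: Type"
| bot_prop: "\<Gamma> \<turnstile> Bot \<^bold>: Prop"

| all_i: "\<Gamma> \<turnstile> \<alpha> \<^bold>: Type \<Longrightarrow> extend \<alpha> \<Gamma> \<turnstile> \<phi> \<Longrightarrow> \<Gamma> \<turnstile> all \<alpha> \<phi>"
| all_e: "\<Gamma> \<turnstile> all \<alpha> \<phi> \<Longrightarrow> \<Gamma> \<turnstile> t \<^bold>: \<alpha> \<Longrightarrow> \<Gamma> \<turnstile> subst 0 t \<phi>"
| all_t: "\<Gamma> \<turnstile> \<alpha> \<^bold>: Type \<Longrightarrow> extend \<alpha> \<Gamma> \<turnstile> \<phi> \<^bold>: Prop \<Longrightarrow> \<Gamma> \<turnstile> all \<alpha> \<phi> \<^bold>: Prop"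

| or_i1: "\<Gamma> \<turnstile> \<phi> \<Longrightarrow> \<Gamma> \<turnstile> \<phi> \<^bold>\<or> \<psi>"
| or_i2: "\<Gamma> \<turnstile> \<psi> \<Longrightarrow> \<Gamma> \<turnstile> \<phi> \<^bold>\<or> \<psi>"
| or_e: "\<Gamma> \<turnstile> \<phi> \<^bold>\<or> \<psi> \<Longrightarrow> insert \<phi> \<Gamma> \<turnstile> \<chi> \<Longrightarrow> insert \<psi> \<Gamma> \<turnstile> \<chi> \<Longrightarrow> \<Gamma> \<turnstile> \<chi>"
| or_t: "\<Gamma> \<turnstile> \<phi> \<^bold>: Prop \<Longrightarrow> \<Gamma> \<turnstile> \<psi> \<^bold>: Prop \<Longrightarrow> \<Gamma> \<turnstile> (\<phi> \<^bold>\<or> \<psi>) \<^bold>: Prop"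

| ex_i: "\<Gamma> \<turnstile> \<alpha> \<^bold>: Type \<Longrightarrow> \<Gamma> \<turnstile> t \<^bold>: \<alpha> \<Longrightarrow> \<Gamma> \<turnstile> subst 0 t \<phi> \<Longrightarrow> \<Gamma> \<turnstile> ex \<alpha> \<phi>"
| ex_e: "\<Gamma> \<turnstile> ex \<alpha> \<phi> \<Longrightarrow> insert \<phi> (extend \<alpha> \<Gamma>) \<turnstile> lift 0 \<psi> \<Longrightarrow> \<Gamma> \<turnstile> \<psi>"

| and_i: "\<Gamma> \<turnstile> \<phi> \<Longrightarrow> \<Gamma> \<turnstile> \<psi> \<Longrightarrow> \<Gamma> \<turnstile> \<phi> \<^bold>\<and> \<psi>"
| and_e1: "\<Gamma> \<turnstile> \<phi> \<^bold>\<and> \<psi> \<Longrightarrow> \<Gamma> \<turnstile> \<phi>"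
| and_e2: "\<Gamma> \<turnstile> \<phi> \<^bold>\<and> \<psi> \<Longrightarrow> \<Gamma> \<turnstile> \<psi>"

| imp_i: "\<Gamma> \<turnstile> \<phi> \<^bold>: Prop \<Longrightarrow> insert \<phi> \<Gamma> \<turnstile> \<psi> \<Longrightarrow> \<Gamma> \<turnstile> \<phi> \<^bold>\<supset> \<psi>"
| imp_e: "\<Gamma> \<turnstile> \<phi> \<^bold>\<supset> \<psi> \<Longrightarrow> \<Gamma> \<turnstile> \<phi> \<Longrightarrow> \<Gamma> \<turnstile> \<psi>"

| bot_e: "\<Gamma> \<turnstile> Bot \<Longrightarrow> \<Gamma> \<turnstile> \<phi>"
| excluded_middle: "\<Gamma> \<turnstile> all Prop (Var 0 \<^bold>\<or> \<^bold>\<not> Var 0)"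

| fun_i: "\<Gamma> \<turnstile> \<alpha> \<^bold>: Type \<Longrightarrow> extend \<alpha> \<Gamma> \<turnstile> t \<^bold>: lift 0 \<beta> \<Longrightarrow> \<Gamma> \<turnstile> Lam t \<^bold>: \<alpha> \<^bold>\<rightarrow> \<beta>"
| fun_e: "\<Gamma> \<turnstile> s \<^bold>: \<alpha> \<^bold>\<rightarrow> \<beta> \<Longrightarrow> \<Gamma> \<turnstile> t \<^bold>: \<alpha> \<Longrightarrow> \<Gamma> \<turnstile> s \<cdot> t \<^bold>: \<beta>"
| fun_t: "\<Gamma> \<turnstile> \<alpha> \<^bold>: Type \<Longrightarrow> \<Gamma> \<turnstile> \<beta> \<^bold>: Type \<Longrightarrow> \<Gamma> \<turnstile> (\<alpha> \<^bold>\<rightarrow> \<beta>) \<^bold>: Type"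

| sub_i: "\<Gamma> \<turnstile> subtype \<alpha> \<phi> \<^bold>: Type \<Longrightarrow> \<Gamma> \<turnstile> t \<^bold>: \<alpha> \<Longrightarrow> \<Gamma> \<turnstile> subst 0 t \<phi> \<Longrightarrow>
    \<Gamma> \<turnstile> t \<^bold>: subtype \<alpha> \<phi>"
| sub_e1: "\<Gamma> \<turnstile> t \<^bold>: subtype \<alpha> \<phi> \<Longrightarrow> \<Gamma> \<turnstile> t \<^bold>: \<alpha>"
| sub_e2: "\<Gamma> \<turnstile> t \<^bold>: subtype \<alpha> \<phi> \<Longrightarrow> \<Gamma> \<turnstile> subst 0 t \<phi>"
| sub_t: "\<Gamma> \<turnstile> \<alpha> \<^bold>: Type \<Longrightarrow> extend \<alpha> \<Gamma> \<turnstile> \<phi> \<^bold>: Prop \<Longrightarrow> \<Gamma> \<turnstile> subtype \<alpha> \<phi> \<^bold>: Type"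

| eps: "\<Gamma> \<turnstile> ex \<alpha> (\<^bold>\<not> Bot) \<Longrightarrow> \<Gamma> \<turnstile> Eps \<cdot> \<alpha> \<^bold>: \<alpha>"

| eq_refl: "\<Gamma> \<turnstile> t \<^bold>= t"
| eq_sym: "\<Gamma> \<turnstile> s \<^bold>= t \<Longrightarrow> \<Gamma> \<turnstile> t \<^bold>= s"
| eq_trans: "\<Gamma> \<turnstile> s \<^bold>= t \<Longrightarrow> \<Gamma> \<turnstile> t \<^bold>= u \<Longrightarrow> \<Gamma> \<turnstile> s \<^bold>= u"
| eq_app: "\<Gamma> \<turnstile> s \<^bold>= s' \<Longrightarrow> \<Gamma> \<turnstile> t \<^bold>= t' \<Longrightarrow> \<Gamma> \<turnstile> s \<cdot> t \<^bold>= s' \<cdot> t'"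
| eq_lam: "up \<Gamma> \<turnstile> t \<^bold>= t' \<Longrightarrow> \<Gamma> \<turnstile> Lam t \<^bold>= Lam t'"
| eq_beta: "\<Gamma> \<turnstile> Lam t \<cdot> s \<^bold>= subst 0 s t"
| eq_mp: "\<Gamma> \<turnstile> \<phi> \<Longrightarrow> \<Gamma> \<turnstile> \<phi> \<^bold>= \<phi>' \<Longrightarrow> \<Gamma> \<turnstile> \<phi>'"

| cond_true: "\<Gamma> \<turnstile> \<phi> \<Longrightarrow> \<Gamma> \<turnstile> Cond \<cdot> \<phi> \<cdot> s \<cdot> t \<^bold>= s"
| cond_false: "\<Gamma> \<turnstile> \<^bold>\<not> \<phi> \<Longrightarrow> \<Gamma> \<turnstile> Cond \<cdot> \<phi> \<cdot> s \<cdot> t \<^bold>= t"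

| test_same: "i < length (sigs \<iota>) \<Longrightarrow> length ts = length (sigs \<iota> ! i) \<Longrightarrow>
    \<Gamma> \<turnstile> Test \<iota> i \<cdot> apps (Constr \<iota> i) ts"
| test_other: "i < length (sigs \<iota>) \<Longrightarrow> j < length (sigs \<iota>) \<Longrightarrow> i \<noteq> j \<Longrightarrow>
    length ts = length (sigs \<iota> ! j) \<Longrightarrow> \<Gamma> \<turnstile> \<^bold>\<not> (Test \<iota> i \<cdot> apps (Constr \<iota> j) ts)"
| destr: "i < length (sigs \<iota>) \<Longrightarrow> length ts = length (sigs \<iota> ! i) \<Longrightarrow> k < length ts \<Longrightarrow>
    \<Gamma> \<turnstile> Destr \<iota> i k \<cdot> apps (Constr \<iota> i) ts \<^bold>= ts ! k"
| constr_t: "i < length (sigs \<iota>) \<Longrightarrow> length ts = length (sigs \<iota> ! i) \<Longrightarrow>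
    (\<And>j. j < length ts \<Longrightarrow> \<Gamma> \<turnstile> ts ! j \<^bold>: Ind (arg_type \<iota> (sigs \<iota> ! i ! j))) \<Longrightarrow>
    \<Gamma> \<turnstile> apps (Constr \<iota> i) ts \<^bold>: Ind \<iota>"
| induction: "(\<And>i. i < length (sigs \<iota>) \<Longrightarrow> ind_context \<iota> i t \<Gamma> \<turnstile> ind_goal \<iota> i t) \<Longrightarrow>
    \<Gamma> \<turnstile> all (Ind \<iota>) (lift 0 t \<cdot> Var 0)"

definition nat_ind :: ind where
  "nat_ind = Mu [] [[None]]"

definition NatT :: "'c trm" where
  "NatT = Ind nat_ind"

definition Zero :: "'c trm" where
  "Zero = Constr nat_ind 0"

definition is_zero :: "'c trm" where
  "is_zero = Test nat_ind 0"

definition Succ :: "'c trm" where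
  "Succ = Constr nat_ind 1"

definition Pred :: "'c trm" where
  "Pred = Lam (Cond \<cdot> (is_zero \<cdot> Var 0) \<cdot> Zero \<cdot> (Destr nat_ind 1 0 \<cdot> Var 0))"

text \<open>Curry's fixpoint combinator \<open>\<lambda>f. (\<lambda>x. f (x x)) (\<lambda>x. f (x x))\<close>.\<close>

definition Fix :: "'c trm" where
  "Fix = Lam (Lam (Var 1 \<cdot> (Var 0 \<cdot> Var 0)) \<cdot> Lam (Var 1 \<cdot> (Var 0 \<cdot> Var 0)))"

text \<open>\<open>Fix (\<lambda>r g h x y. Cond (is_zero y) (g x) (h x (Pred y) (r g h x (Pred y))))\<close>\<close>

definition Rec :: "'c trm" where
  "Rec = Fix \<cdot> Lam (Lam (Lam (Lam (Lam
     (Cond \<cdot> (is_zero \<cdot> Var 0) \<cdot> (Var 3 \<cdot> Var 1)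
       \<cdot> (Var 2 \<cdot> Var 1 \<cdot> (Pred \<cdot> Var 0)
           \<cdot> (Var 4 \<cdot> Var 3 \<cdot> Var 2 \<cdot> Var 1 \<cdot> (Pred \<cdot> Var 0))))))))"

definition nat_plus :: "'c trm \<Rightarrow> 'c trm \<Rightarrow> 'c trm"  (infixl \<open>\<^bold>+\<close> 85) where
  "s \<^bold>+ t = Rec \<cdot> Lam (Var 0) \<cdot> Lam (Lam (Lam (Succ \<cdot> Var 0))) \<cdot> s \<cdot> t"

definition nat_times :: "'c trm \<Rightarrow> 'c trm \<Rightarrow> 'c trm"  (infixl \<open>\<^bold>*\<close> 90) where
  "s \<^bold>* t = Rec \<cdot> Lam Zero \<cdot> Lam (Lam (Lam (Var 2 \<^bold>+ Var 0))) \<cdot> s \<cdot> t"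

end

theory Submission
  imports Defs
begin

text \<open>
  The recursion equations of \<open>\<^bold>+\<close> and \<open>\<^bold>*\<close> hold for \<open>\<^bold>=\<close> on arbitrary untyped terms. Since the
  induction rule puts no restriction on its predicate, it applies directly to predicates such as
  \<open>x \<^bold>+ y \<^bold>: NatT\<close> and \<open>x \<^bold>+ y \<^bold>= y \<^bold>+ x\<close>, which are not known to be propositions; this yields the
  typing of the operations and the commutativity of \<open>\<^bold>+\<close>, which the last formula needs because
  the recursor gives \<open>x \<^bold>* (Succ \<cdot> y) \<^bold>= x \<^bold>+ (x \<^bold>* y)\<close>. An equation between terms of type
  \<open>NatT\<close> implies the corresponding Leibniz equality. For the first two formulas the Leibniz
  equality is instantiated with \<open>\<lambda>z. p (Pred z)\<close> and with \<open>\<lambda>z. Cond (is_zero z) \<bottom> (\<not> \<bottom>)\<close>; the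
  detour through \<open>Cond\<close> is needed since \<open>is_zero z\<close> itself has no typing rule.
\<close>

section \<open>Lifting and substitution\<close>

text \<open>The cut-offs are general because each \<open>Lam\<close> raises both of them by
  one.\<close>

lemma lift_lift: "i \<le> k \<Longrightarrow> lift (Suc k) (lift i t) = lift i (lift k t)"
  by (induction t arbitrary: i k) auto

lemma lift_Suc_lift_0 [simp]: "lift (Suc k) (lift 0 t) = lift 0 (lift k t)"
  by (simp add: lift_lift)

lemma subst_lift [simp]: "subst k s (lift k t) = t"
  by (induction t arbitrary: k s) auto

text \<open>For \<open>k = 0\<close> this computes the reduct of
  \<open>lift 0 (Lam t) \<cdot> Var 0\<close>: a lifted abstraction applied to the freed variable
  gives back its body \<open>t\<close>.\<close>

lemma subst_Var_lift [simp]: "subst k (Var k) (lift (Suc k) t) = t"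
  by (induction t arbitrary: k) auto

lemma subst_Suc_lift:
  "i \<le> k \<Longrightarrow> subst (Suc k) (lift i s) (lift i t) = lift i (subst k s t)"
proof (induction t arbitrary: i k s)
  case (Var j)
  then show ?case by (cases j) auto
next
  case (Lam t)
  \<comment> \<open>Below the binder the induction hypothesis applies with \<open>Suc i\<close>,
    \<open>Suc k\<close> and \<open>lift 0 s\<close>, so the two lifts of \<open>s\<close> have to
    be interchanged.\<close>
  have "lift 0 (lift i s) = lift (Suc i) (lift 0 s)" by simp
  then show ?case using Lam by (metis Suc_le_mono lift.simps(9) subst.simps(9))
qed auto

lemma subst_Suc_lift_0 [simp]: "subst (Suc k) (lift 0 s) (lift 0 t) = lift 0 (subst k s t)"
  by (simp add: subst_Suc_lift)

text \<open>The substituted variable lies at or below the cut-off, so removing it lowers the cut-off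
  from \<open>Suc k\<close> to \<open>k\<close>. Rules that mention \<open>subst 0\<close> survive
  lifting because of this.\<close>

lemma lift_subst:
  "i \<le> k \<Longrightarrow> lift k (subst i s t) = subst i (lift k s) (lift (Suc k) t)"
proof (induction t arbitrary: i k s)
  case (Lam t)
  then show ?case by simp
qed auto

lemma lift_subst_0: "lift k (subst 0 s t) = subst 0 (lift k s) (lift (Suc k) t)"
  by (simp add: lift_subst)

section \<open>Lifting and substitution through connectives and arithmetic terms\<close>

lemma lift_connectives [simp]:
  "lift k (s \<^bold>: t) = (lift k s \<^bold>: lift k t)"
  "lift k (s \<^bold>\<rightarrow> t) = (lift k s \<^bold>\<rightarrow> lift k t)"
  "lift k (s \<^bold>= t) = (lift k s \<^bold>= lift k t)"
  "lift k (all s t) = all (lift k s) (lift (Suc k) t)"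
  "lift k (subtype s t) = subtype (lift k s) (lift (Suc k) t)"
  "lift k (s \<^bold>\<supset> t) = (lift k s \<^bold>\<supset> lift k t)"
  "lift k (\<^bold>\<not> s) = \<^bold>\<not> lift k s"
  "lift k (s \<^bold>=\<^bsub>u\<^esub> t) = (lift k s \<^bold>=\<^bsub>lift k u\<^esub> lift k t)"
  "lift k (s \<^bold>\<or> t) = (lift k s \<^bold>\<or> lift k t)"
  "lift k (s \<^bold>\<and> t) = (lift k s \<^bold>\<and> lift k t)"
  "lift k (ex s t) = ex (lift k s) (lift (Suc k) t)"
  by (simp_all add: is_type_def fun_type_def equal_def all_def subtype_def imp_def neg_def
      leibniz_def lor_def land_def ex_def lift_lift)

lemma subst_connectives [simp]:
  "subst k r (s \<^bold>: t) = (subst k r s \<^bold>: subst k r t)"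
  "subst k r (s \<^bold>\<rightarrow> t) = (subst k r s \<^bold>\<rightarrow> subst k r t)"
  "subst k r (s \<^bold>= t) = (subst k r s \<^bold>= subst k r t)"
  "subst k r (all s t) = all (subst k r s) (subst (Suc k) (lift 0 r) t)"
  "subst k r (subtype s t) = subtype (subst k r s) (subst (Suc k) (lift 0 r) t)"
  "subst k r (s \<^bold>\<supset> t) = (subst k r s \<^bold>\<supset> subst k r t)"
  "subst k r (\<^bold>\<not> s) = \<^bold>\<not> subst k r s"
  "subst k r (s \<^bold>=\<^bsub>u\<^esub> t) = (subst k r s \<^bold>=\<^bsub>subst k r u\<^esub> subst k r t)"
  by (simp_all add: is_type_def fun_type_def equal_def all_def subtype_def imp_def neg_def
      leibniz_def)

lemma lift_arith [simp]:
  "lift k NatT = NatT" "lift k Zero = Zero" "lift k is_zero = is_zero" "lift k Succ = Succ"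
  "lift k Pred = Pred" "lift k Rec = Rec"
  "lift k (s \<^bold>+ t) = lift k s \<^bold>+ lift k t"
  "lift k (s \<^bold>* t) = lift k s \<^bold>* lift k t"
  by (simp_all add: NatT_def Zero_def is_zero_def Succ_def Pred_def Fix_def Rec_def nat_plus_def
      nat_times_def)

lemma subst_arith [simp]:
  "subst k r NatT = NatT" "subst k r Zero = Zero" "subst k r is_zero = is_zero"
  "subst k r Succ = Succ" "subst k r Pred = Pred" "subst k r Rec = Rec"
  "subst k r (s \<^bold>+ t) = subst k r s \<^bold>+ subst k r t"
  "subst k r (s \<^bold>* t) = subst k r s \<^bold>* subst k r t"
  by (simp_all add: NatT_def Zero_def is_zero_def Succ_def Pred_def Fix_def Rec_def nat_plus_def
      nat_times_def)

lemma up_insert [simp]: "up (insert \<phi> \<Gamma>) = insert (lift 0 \<phi>) (up \<Gamma>)"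
  by (simp add: up_def)

lemma extend_unfold [simp]: "extend \<alpha> \<Gamma> = insert (Var 0 \<^bold>: lift 0 \<alpha>) (up \<Gamma>)"
  by (simp add: extend_def)

lemma up_mono: "\<Gamma> \<subseteq> \<Delta> \<Longrightarrow> up \<Gamma> \<subseteq> up \<Delta>"
  by (auto simp: up_def)

lemma extend_mono: "\<Gamma> \<subseteq> \<Delta> \<Longrightarrow> extend \<alpha> \<Gamma> \<subseteq> extend \<alpha> \<Delta>"
  by (auto simp: up_def)

section \<open>Derived rules\<close>

text \<open>The larger context is generalised, since rules that discharge a hypothesis or open a
  fresh variable call the induction hypothesis at a changed context. There \<open>insert\<close>,
  \<open>extend\<close>, \<open>up\<close> and \<open>ind_context\<close> are monotone.\<close>

lemma weakening: "\<Gamma> \<turnstile> \<phi> \<Longrightarrow> \<Gamma> \<subseteq> \<Delta> \<Longrightarrow> \<Delta> \<turnstile> \<phi>"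
proof (induction arbitrary: \<Delta> rule: derives.induct)
  case (all_i \<Gamma> \<alpha> \<phi>)
  then show ?case using derives.all_i[of \<Delta> \<alpha> \<phi>] extend_mono[of \<Gamma> \<Delta> \<alpha>] by simp
next
  case (all_e \<Gamma> \<alpha> \<phi> t)
  then show ?case using derives.all_e[of \<Delta> \<alpha> \<phi> t] by simp
next
  case (all_t \<Gamma> \<alpha> \<phi>)
  then show ?case using derives.all_t[of \<Delta> \<alpha> \<phi>] extend_mono[of \<Gamma> \<Delta> \<alpha>] by simp
next
  case (or_e \<Gamma> \<phi> \<psi> \<chi>)
  then show ?case
    by (intro derives.or_e[of \<Delta> \<phi> \<psi> \<chi>]) (simp_all add: subset_insertI2)
next
  case (ex_e \<Gamma> \<alpha> \<phi> \<psi>)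
  have "insert \<phi> (extend \<alpha> \<Gamma>) \<subseteq> insert \<phi> (extend \<alpha> \<Delta>)"
    using ex_e.prems by (intro insert_mono extend_mono)
  with ex_e show ?case using derives.ex_e[of \<Delta> \<alpha> \<phi> \<psi>] by simp
next
  case (ex_i \<Gamma> \<alpha> t \<phi>)
  then show ?case using derives.ex_i[of \<Delta> \<alpha> t \<phi>] by simp
next
  case (imp_i \<Gamma> \<phi> \<psi>)
  then show ?case
    by (intro derives.imp_i[of \<Delta> \<phi> \<psi>]) (simp_all add: subset_insertI2)
next
  case (fun_i \<Gamma> \<alpha> t \<beta>)
  then show ?case using derives.fun_i[of \<Delta> \<alpha> t \<beta>] extend_mono[of \<Gamma> \<Delta> \<alpha>] by simp
next
  case (sub_t \<Gamma> \<alpha> \<phi>)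
  then show ?case using derives.sub_t[of \<Delta> \<alpha> \<phi>] extend_mono[of \<Gamma> \<Delta> \<alpha>] by simp
next
  case (eq_lam \<Gamma> t t')
  then show ?case using derives.eq_lam[of \<Delta> t t'] up_mono[of \<Gamma> \<Delta>] by simp
next
  case (induction \<iota> t \<Gamma>)
  have "ind_context \<iota> i t \<Gamma> \<subseteq> ind_context \<iota> i t \<Delta>" for i
    using induction.prems by (auto simp: ind_context_def)
  with induction.IH show ?case using derives.induction[of \<iota> t \<Delta>] by simp
next
  case (hyp \<phi> \<Gamma>)
  then show ?case by (blast intro: derives.hyp)
next
  case (and_e1 \<Gamma> \<phi> \<psi>)
  then show ?case using derives.and_e1[of \<Delta> \<phi> \<psi>] by simp
next
  case (and_e2 \<Gamma> \<phi> \<psi>)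
  then show ?case using derives.and_e2[of \<Delta> \<phi> \<psi>] by simp
next
  case (imp_e \<Gamma> \<phi> \<psi>)
  then show ?case using derives.imp_e[of \<Delta> \<phi> \<psi>] by simp
next
  case (bot_e \<Gamma> \<phi>)
  then show ?case using derives.bot_e[of \<Delta> \<phi>] by simp
next
  case (fun_e \<Gamma> s \<alpha> \<beta> t)
  then show ?case using derives.fun_e[of \<Delta> s \<alpha> \<beta> t] by simp
next
  case (sub_e1 \<Gamma> t \<alpha> \<phi>)
  then show ?case using derives.sub_e1[of \<Delta> t \<alpha> \<phi>] by simp
next
  case (sub_e2 \<Gamma> t \<alpha> \<phi>)
  then show ?case using derives.sub_e2[of \<Delta> t \<alpha> \<phi>] by simp
next
  case (eq_sym \<Gamma> s t)
  then show ?case using derives.eq_sym[of \<Delta> s t] by simp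
next
  case (eq_trans \<Gamma> s t u)
  then show ?case using derives.eq_trans[of \<Delta> s t u] by simp
next
  case (eq_mp \<Gamma> \<phi> \<phi>')
  then show ?case using derives.eq_mp[of \<Delta> \<phi> \<phi>'] by simp
qed (simp_all add: prop_type ind_type bot_prop or_i1 or_i2 or_t and_i excluded_middle
    fun_t sub_i eps eq_refl eq_app eq_beta cond_true cond_false test_same test_other destr constr_t)

section \<open>Stability of derivations under lifting\<close>

lemma image_lift_extend: "lift (Suc k) ` extend \<alpha> \<Gamma> = extend (lift k \<alpha>) (lift k ` \<Gamma>)"
  by (simp add: up_def image_image)

text \<open>The induction rule opens one variable per constructor argument at once, so a cut-off
  \<open>k\<close> outside becomes \<open>k\<close> plus the arity inside.\<close>

lemma lift_ind_shift:
  "lift (k + length (sigs \<iota> ! i)) (ind_shift \<iota> i t) = ind_shift \<iota> i (lift k t)"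
proof -
  have "lift (k + n) ((lift 0 ^^ n) t) = (lift 0 ^^ n) (lift k t)" for n
    by (induction n) auto
  then show ?thesis
    by (simp add: ind_shift_def)
qed

lemma lift_ind_var:
  "j < length (sigs \<iota> ! i) \<Longrightarrow> lift (k + length (sigs \<iota> ! i)) (ind_var \<iota> i j) = ind_var \<iota> i j"
  by (simp add: ind_var_def)

lemma lift_apps: "lift k (apps t ts) = apps (lift k t) (map (lift k) ts)"
  unfolding apps_def by (induction ts arbitrary: t) auto

lemma lift_ind_goal:
  "lift (k + length (sigs \<iota> ! i)) (ind_goal \<iota> i (t :: 'c trm)) = ind_goal \<iota> i (lift k t)"
proof -
  let ?n = "length (sigs \<iota> ! i)"
  have "map (lift (k + ?n)) (map (ind_var \<iota> i) [0..<?n]) =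
      (map (ind_var \<iota> i) [0..<?n] :: 'c trm list)"
    by (simp add: lift_ind_var)
  then show ?thesis
    by (simp add: ind_goal_def lift_ind_shift lift_apps del: map_map)
qed

text \<open>Inclusion is the form in which \<open>weakening\<close> passes from the lifted context
  to the context built from lifted data. The argument variables lie below the cut-off and stay
  fixed.\<close>

lemma image_lift_ind_context:
  "lift (k + length (sigs \<iota> ! i)) ` ind_context \<iota> i t \<Gamma> \<subseteq> ind_context \<iota> i (lift k t) (lift k ` \<Gamma>)"
  by (auto simp: ind_context_def lift_ind_shift lift_ind_var)

text \<open>A derivation stays valid when a fresh variable is inserted at position \<open>k\<close>.
  The position varies in the induction because every opened binder raises it.\<close>

lemma lift_derives: "\<Gamma> \<turnstile> \<phi> \<Longrightarrow> lift k ` \<Gamma> \<turnstile> lift k \<phi>"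
proof (induction arbitrary: k rule: derives.induct)
  case (all_i \<Gamma> \<alpha> \<phi>)
  show ?case
    using derives.all_i[of "lift k ` \<Gamma>" "lift k \<alpha>" "lift (Suc k) \<phi>"]
      all_i.IH(1)[of k] all_i.IH(2)[of "Suc k"]
    by (simp add: image_lift_extend del: extend_unfold)
next
  case (all_e \<Gamma> \<alpha> \<phi> t)
  show ?case
    using derives.all_e[of "lift k ` \<Gamma>" "lift k \<alpha>" "lift (Suc k) \<phi>" "lift k t"]
      all_e.IH(1)[of k] all_e.IH(2)[of k]
    by (simp add: lift_subst_0)
next
  case (all_t \<Gamma> \<alpha> \<phi>)
  show ?case
    using derives.all_t[of "lift k ` \<Gamma>" "lift k \<alpha>" "lift (Suc k) \<phi>"]
      all_t.IH(1)[of k] all_t.IH(2)[of "Suc k"]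
    by (simp add: image_lift_extend del: extend_unfold)
next
  case (or_e \<Gamma> \<phi> \<psi> \<chi>)
  show ?case
    using derives.or_e[of "lift k ` \<Gamma>" "lift k \<phi>" "lift k \<psi>" "lift k \<chi>"]
      or_e.IH(1)[of k] or_e.IH(2)[of k] or_e.IH(3)[of k]
    by simp
next
  case (ex_i \<Gamma> \<alpha> t \<phi>)
  show ?case
    using derives.ex_i[of "lift k ` \<Gamma>" "lift k \<alpha>" "lift k t" "lift (Suc k) \<phi>"]
      ex_i.IH(1)[of k] ex_i.IH(2)[of k] ex_i.IH(3)[of k]
    by (simp add: lift_subst_0)
next
  case (ex_e \<Gamma> \<alpha> \<phi> \<psi>)
  show ?case
    using derives.ex_e[of "lift k ` \<Gamma>" "lift k \<alpha>" "lift (Suc k) \<phi>" "lift k \<psi>"]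
      ex_e.IH(1)[of k] ex_e.IH(2)[of "Suc k"]
    by (simp add: image_lift_extend del: extend_unfold)
next
  case (imp_i \<Gamma> \<phi> \<psi>)
  show ?case
    using derives.imp_i[of "lift k ` \<Gamma>" "lift k \<phi>" "lift k \<psi>"]
      imp_i.IH(1)[of k] imp_i.IH(2)[of k]
    by simp
next
  case (fun_i \<Gamma> \<alpha> t \<beta>)
  show ?case
    using derives.fun_i[of "lift k ` \<Gamma>" "lift k \<alpha>" "lift (Suc k) t" "lift k \<beta>"]
      fun_i.IH(1)[of k] fun_i.IH(2)[of "Suc k"]
    by (simp add: image_lift_extend del: extend_unfold)
next
  case (sub_i \<Gamma> \<alpha> \<phi> t)
  show ?case
    using derives.sub_i[of "lift k ` \<Gamma>" "lift k \<alpha>" "lift (Suc k) \<phi>" "lift k t"]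
      sub_i.IH(1)[of k] sub_i.IH(2)[of k] sub_i.IH(3)[of k]
    by (simp add: lift_subst_0)
next
  case (sub_e2 \<Gamma> t \<alpha> \<phi>)
  show ?case
    using derives.sub_e2[of "lift k ` \<Gamma>" "lift k t" "lift k \<alpha>" "lift (Suc k) \<phi>"] sub_e2.IH[of k]
    by (simp add: lift_subst_0)
next
  case (sub_t \<Gamma> \<alpha> \<phi>)
  show ?case
    using derives.sub_t[of "lift k ` \<Gamma>" "lift k \<alpha>" "lift (Suc k) \<phi>"]
      sub_t.IH(1)[of k] sub_t.IH(2)[of "Suc k"]
    by (simp add: image_lift_extend del: extend_unfold)
next
  case (eq_lam \<Gamma> t t')
  have "lift (Suc k) ` up \<Gamma> = up (lift k ` \<Gamma>)"
    by (simp add: up_def image_image)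
  then show ?case using eq_lam.IH[of "Suc k"] by (simp add: derives.eq_lam)
next
  case (eq_beta \<Gamma> t s)
  then show ?case using derives.eq_beta by (simp add: lift_subst_0)
next
  case (eps \<Gamma> \<alpha>)
  then show ?case using derives.eps[of _ "lift k \<alpha>"] by simp
next
  case (test_same i \<iota> ts \<Gamma>)
  then show ?case by (simp add: lift_apps derives.test_same)
next
  case (test_other i \<iota> j ts \<Gamma>)
  then show ?case by (simp add: lift_apps derives.test_other)
next
  case (destr i \<iota> ts n \<Gamma>)
  then show ?case using derives.destr[of i \<iota> "map (lift k) ts" n] by (simp add: lift_apps)
next
  case (constr_t i \<iota> ts \<Gamma>)
  then show ?case using derives.constr_t[of i \<iota> "map (lift k) ts"] by (simp add: lift_apps)
next
  case (induction \<iota> t \<Gamma>)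
  \<comment> \<open>The induction hypothesis is taken at \<open>k\<close> plus the arity of the
    constructor, which is the position as seen beneath its argument variables.\<close>
  have "ind_context \<iota> i (lift k t) (lift k ` \<Gamma>) \<turnstile> ind_goal \<iota> i (lift k t)"
    if "i < length (sigs \<iota>)" for i
    using weakening[OF induction.IH[OF that] image_lift_ind_context] by (simp add: lift_ind_goal)
  then show ?case using derives.induction[of \<iota> "lift k t" "lift k ` \<Gamma>"] by simp
next
  case (and_e1 \<Gamma> \<phi> \<psi>)
  then show ?case
    using derives.and_e1[of "lift k ` \<Gamma>" "lift k \<phi>" "lift k \<psi>"] by simp
next
  case (and_e2 \<Gamma> \<phi> \<psi>)
  then show ?case
    using derives.and_e2[of "lift k ` \<Gamma>" "lift k \<phi>" "lift k \<psi>"] by simp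
next
  case (imp_e \<Gamma> \<phi> \<psi>)
  then show ?case
    using derives.imp_e[of "lift k ` \<Gamma>" "lift k \<phi>" "lift k \<psi>"] by simp
next
  case (bot_e \<Gamma> \<phi>)
  then show ?case
    using derives.bot_e[of "lift k ` \<Gamma>" "lift k \<phi>"] by simp
next
  case (fun_e \<Gamma> s \<alpha> \<beta> t)
  then show ?case
    using derives.fun_e[of "lift k ` \<Gamma>" "lift k s" "lift k \<alpha>" "lift k \<beta>" "lift k t"] by simp
next
  case (sub_e1 \<Gamma> t \<alpha> \<phi>)
  then show ?case
    using derives.sub_e1[of "lift k ` \<Gamma>" "lift k t" "lift k \<alpha>" "lift (Suc k) \<phi>"] by simp
next
  case (eq_sym \<Gamma> s t)
  then show ?case
    using derives.eq_sym[of "lift k ` \<Gamma>" "lift k s" "lift k t"] by simp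
next
  case (eq_trans \<Gamma> s t u)
  then show ?case
    using derives.eq_trans[of "lift k ` \<Gamma>" "lift k s" "lift k t" "lift k u"] by simp
next
  case (eq_mp \<Gamma> \<phi> \<phi>')
  then show ?case
    using derives.eq_mp[of "lift k ` \<Gamma>" "lift k \<phi>" "lift k \<phi>'"] by simp
qed (simp_all add: derives.hyp prop_type ind_type bot_prop or_i1 or_i2 or_t and_i excluded_middle
    fun_t eq_refl eq_app cond_true cond_false)

lemma extend_lift: "\<Gamma> \<turnstile> \<phi> \<Longrightarrow> extend \<alpha> \<Gamma> \<turnstile> lift 0 \<phi>"
  by (rule weakening[OF lift_derives]) (auto simp: up_def)

text \<open>A cut through \<open>\<supset>\<close> would require \<open>\<phi> \<^bold>: Prop\<close>; disjunction elimination does not.\<close>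

lemma cut: "\<Gamma> \<turnstile> \<phi> \<Longrightarrow> insert \<phi> \<Gamma> \<turnstile> \<psi> \<Longrightarrow> \<Gamma> \<turnstile> \<psi>"
  by (rule or_e[OF or_i1])

section \<open>Instantiation, equality and implication\<close>

text \<open>The instance is given by an equation, so that the substitution can be computed into the
  wanted formula.\<close>

lemma all_inst: "\<Gamma> \<turnstile> all \<alpha> \<phi> \<Longrightarrow> \<Gamma> \<turnstile> t \<^bold>: \<alpha> \<Longrightarrow> subst 0 t \<phi> = \<psi> \<Longrightarrow> \<Gamma> \<turnstile> \<psi>"
  using all_e by blast

lemma eq_beta': "subst 0 s t = u \<Longrightarrow> \<Gamma> \<turnstile> Lam t \<cdot> s \<^bold>= u"
  using eq_beta by blast

lemma eq_fun: "\<Gamma> \<turnstile> s \<^bold>= s' \<Longrightarrow> \<Gamma> \<turnstile> s \<cdot> t \<^bold>= s' \<cdot> t"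
  by (rule eq_app[OF _ eq_refl])

lemma eq_arg: "\<Gamma> \<turnstile> t \<^bold>= t' \<Longrightarrow> \<Gamma> \<turnstile> s \<cdot> t \<^bold>= s \<cdot> t'"
  by (rule eq_app[OF eq_refl])

lemma eq_mp_sym: "\<Gamma> \<turnstile> \<phi>' \<Longrightarrow> \<Gamma> \<turnstile> \<phi> \<^bold>= \<phi>' \<Longrightarrow> \<Gamma> \<turnstile> \<phi>"
  by (blast intro: eq_mp eq_sym)

text \<open>Typing statements are ordinary terms headed by \<open>Is\<close>, so the congruence
  rules transport them along \<open>Eq\<close>. This is how values computed by \<open>Cond\<close>
  or \<open>Rec\<close> get their types.\<close>

lemma type_cong: "\<Gamma> \<turnstile> t \<^bold>: \<alpha> \<Longrightarrow> \<Gamma> \<turnstile> s \<^bold>= t \<Longrightarrow> \<Gamma> \<turnstile> s \<^bold>: \<alpha>"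
  unfolding is_type_def by (blast intro: eq_mp_sym eq_fun eq_arg)

text \<open>An implication quantifies over the subtype of \<open>Prop\<close> cut out by
  \<open>\<phi>\<close>. Typing \<open>\<phi>\<close> makes that subtype a type, and
  \<open>\<psi>\<close> is typed in the context extended by an element of it.\<close>

lemma imp_t:
  assumes "\<Gamma> \<turnstile> \<phi> \<^bold>: Prop" "\<Gamma> \<turnstile> \<psi> \<^bold>: Prop"
  shows "\<Gamma> \<turnstile> (\<phi> \<^bold>\<supset> \<psi>) \<^bold>: Prop"
  unfolding imp_def
  using extend_lift[OF assms(1), where \<alpha> = Prop]
    extend_lift[OF assms(2), where \<alpha> = "subtype Prop (lift 0 \<phi>)"]
  by (intro all_t sub_t prop_type) simp_all

lemma not_bot: "\<Gamma> \<turnstile> \<^bold>\<not> Bot"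
  unfolding neg_def by (intro imp_i bot_prop hyp) simp

lemma not_bot_prop: "\<Gamma> \<turnstile> (\<^bold>\<not> Bot) \<^bold>: Prop"
  unfolding neg_def by (intro imp_t bot_prop)

section \<open>Natural numbers\<close>

lemma NatT_type: "\<Gamma> \<turnstile> NatT \<^bold>: Type"
  unfolding NatT_def by (rule ind_type)

lemma NatT_pred_type: "\<Gamma> \<turnstile> (NatT \<^bold>\<rightarrow> Prop) \<^bold>: Type"
  by (intro fun_t NatT_type prop_type)

lemma Zero_type: "\<Gamma> \<turnstile> Zero \<^bold>: NatT"
  using constr_t[of 0 nat_ind "[]" \<Gamma>] by (simp add: nat_ind_def Zero_def NatT_def apps_def)

lemma Succ_type: "\<Gamma> \<turnstile> t \<^bold>: NatT \<Longrightarrow> \<Gamma> \<turnstile> Succ \<cdot> t \<^bold>: NatT"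
  using constr_t[of 1 nat_ind "[t]" \<Gamma>]
  by (simp add: nat_ind_def Succ_def NatT_def apps_def arg_type_def)

lemma is_zero_Zero: "\<Gamma> \<turnstile> is_zero \<cdot> Zero"
  using test_same[of 0 nat_ind "[]" \<Gamma>] by (simp add: nat_ind_def Zero_def is_zero_def apps_def)

lemma not_is_zero_Succ: "\<Gamma> \<turnstile> \<^bold>\<not> (is_zero \<cdot> (Succ \<cdot> t))"
  using test_other[of 0 nat_ind 1 "[t]" \<Gamma>]
  by (simp add: nat_ind_def Succ_def is_zero_def apps_def)

lemma Destr_Succ: "\<Gamma> \<turnstile> Destr nat_ind 1 0 \<cdot> (Succ \<cdot> t) \<^bold>= t"
  using destr[of 1 nat_ind "[t]" 0 \<Gamma>] by (simp add: nat_ind_def Succ_def apps_def)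

lemma Pred_Zero: "\<Gamma> \<turnstile> Pred \<cdot> Zero \<^bold>= Zero"
  unfolding Pred_def by (rule eq_trans[OF eq_beta' cond_true[OF is_zero_Zero]]) simp

lemma Pred_Succ: "\<Gamma> \<turnstile> Pred \<cdot> (Succ \<cdot> t) \<^bold>= t"
  unfolding Pred_def
  by (rule eq_trans[OF eq_beta' eq_trans[OF cond_false[OF not_is_zero_Succ] Destr_Succ]]) simp

section \<open>Induction over natural numbers\<close>

lemma nat_all_inst2:
  assumes "\<Gamma> \<turnstile> all NatT (all NatT \<phi>)" "\<Gamma> \<turnstile> s \<^bold>: NatT" "\<Gamma> \<turnstile> t \<^bold>: NatT"
    "subst 0 t (subst 1 (lift 0 s) \<phi>) = \<psi>"
  shows "\<Gamma> \<turnstile> \<psi>"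
proof -
  have "\<Gamma> \<turnstile> all NatT (subst 1 (lift 0 s) \<phi>)"
    using assms(1,2) by (rule all_inst) simp
  then show ?thesis
    using assms(3,4) by (rule all_inst)
qed

text \<open>The primitive rule speaks of a term applied to its argument. Taking
  \<open>Lam \<phi>\<close> for that term, \<beta>-equality and \<open>eq_mp\<close> translate
  between the applications and the instances of \<open>\<phi>\<close>.\<close>

lemma nat_induction:
  assumes zero: "\<Gamma> \<turnstile> subst 0 Zero \<phi>"
    and succ: "insert \<phi> (extend NatT \<Gamma>) \<turnstile> subst 0 (Succ \<cdot> Var 0) (lift 1 \<phi>)"
  shows "\<Gamma> \<turnstile> all NatT \<phi>"
proof -
  define T where "T = Lam \<phi>"
  have lift_T: "lift 0 T = Lam (lift 1 \<phi>)"
    by (simp add: T_def)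
  have beta: "\<Delta> \<turnstile> lift 0 T \<cdot> Var 0 \<^bold>= \<phi>" for \<Delta>
    unfolding lift_T by (rule eq_beta') simp
  have base: "ind_context nat_ind 0 T \<Gamma> \<turnstile> ind_goal nat_ind 0 T"
    using eq_mp_sym[OF zero eq_beta]
    by (simp add: ind_context_def ind_goal_def ind_shift_def nat_ind_def apps_def Zero_def T_def)
  let ?\<Delta> = "insert (lift 0 T \<cdot> Var 0) (extend NatT \<Gamma>)"
  have "?\<Delta> \<turnstile> lift 0 T \<cdot> Var 0"
    by (rule hyp) simp
  then have "?\<Delta> \<turnstile> \<phi>"
    using beta by (rule eq_mp)
  \<comment> \<open>The rule supplies \<open>lift 0 T \<cdot> Var 0\<close> where
    \<open>succ\<close> assumes \<open>\<phi>\<close>; \<open>cut\<close> bridges this for an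
    arbitrary \<open>\<phi>\<close>.\<close>
  then have "?\<Delta> \<turnstile> subst 0 (Succ \<cdot> Var 0) (lift 1 \<phi>)"
    using succ by (auto intro: cut weakening)
  then have "?\<Delta> \<turnstile> lift 0 T \<cdot> (Succ \<cdot> Var 0)"
    unfolding lift_T using eq_beta by (rule eq_mp_sym)
  moreover have "ind_context nat_ind 1 T \<Gamma> = ?\<Delta>"
    by (auto simp: ind_context_def ind_shift_def ind_var_def nat_ind_def arg_type_def NatT_def
        up_def)
  moreover have "ind_goal nat_ind 1 T = lift 0 T \<cdot> (Succ \<cdot> Var 0)"
    by (simp add: ind_goal_def ind_shift_def ind_var_def nat_ind_def apps_def Succ_def)
  ultimately have step: "ind_context nat_ind 1 T \<Gamma> \<turnstile> ind_goal nat_ind 1 T"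
    by simp
  have "i = 0 \<or> i = 1" if "i < length (sigs nat_ind)" for i
    using that by (auto simp: nat_ind_def)
  then have "\<Gamma> \<turnstile> all NatT (lift 0 T \<cdot> Var 0)"
    unfolding NatT_def using base step by (blast intro: induction)
  \<comment> \<open>Congruence under \<open>Lam\<close> carries the \<beta>-step into the body of
    the quantifier.\<close>
  then show ?thesis
    by (rule eq_mp) (unfold all_def, intro eq_arg eq_lam beta)
qed

section \<open>The fixpoint combinator and the recursor\<close>

text \<open>Both sides meet in the self-application of \<open>?w\<close>:
  \<open>Fix \<cdot> f\<close> reduces to it, and it reduces to \<open>f\<close> applied to
  itself.\<close>

lemma Fix_eq: "\<Gamma> \<turnstile> Fix \<cdot> f \<^bold>= f \<cdot> (Fix \<cdot> f)"
proof -
  let ?w = "Lam (lift 0 f \<cdot> (Var 0 \<cdot> Var 0))"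
  have unfold: "\<Gamma> \<turnstile> Fix \<cdot> f \<^bold>= ?w \<cdot> ?w"
    unfolding Fix_def by (rule eq_beta') simp
  have "\<Gamma> \<turnstile> ?w \<cdot> ?w \<^bold>= f \<cdot> (?w \<cdot> ?w)"
    by (rule eq_beta') simp
  with unfold show ?thesis
    by (blast intro: eq_trans eq_arg eq_sym)
qed

text \<open>One unrolling of the fixpoint followed by five \<beta>-steps, one for each of the
  recursor itself, \<open>g\<close>, \<open>h\<close>, \<open>x\<close> and
  \<open>y\<close>.\<close>

lemma Rec_eq:
  "\<Gamma> \<turnstile> Rec \<cdot> g \<cdot> h \<cdot> x \<cdot> y \<^bold>=
    Cond \<cdot> (is_zero \<cdot> y) \<cdot> (g \<cdot> x) \<cdot> (h \<cdot> x \<cdot> (Pred \<cdot> y) \<cdot> (Rec \<cdot> g \<cdot> h \<cdot> x \<cdot> (Pred \<cdot> y)))"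
proof -
  let ?b = "Cond \<cdot> (is_zero \<cdot> Var 0) \<cdot> (Var 3 \<cdot> Var 1)
       \<cdot> (Var 2 \<cdot> Var 1 \<cdot> (Pred \<cdot> Var 0)
           \<cdot> (Var 4 \<cdot> Var 3 \<cdot> Var 2 \<cdot> Var 1 \<cdot> (Pred \<cdot> Var 0)))"
  \<comment> \<open>The body after substituting the recursor, then \<open>g\<close>,
    \<open>h\<close> and \<open>x\<close>. Each argument is lifted once per binder still in front of
    the body; \<open>Rec\<close> is closed and hence unchanged by lifting.\<close>
  let ?b4 = "subst 4 Rec ?b"
  let ?b3 = "subst 3 (lift 0 (lift 0 (lift 0 g))) ?b4"
  let ?b2 = "subst 2 (lift 0 (lift 0 h)) ?b3"
  let ?b1 = "subst 1 (lift 0 x) ?b2"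
  have "\<Gamma> \<turnstile> Rec \<^bold>= Lam (Lam (Lam (Lam (Lam ?b)))) \<cdot> Rec"
    unfolding Rec_def by (rule Fix_eq)
  moreover have "\<Gamma> \<turnstile> Lam (Lam (Lam (Lam (Lam ?b)))) \<cdot> Rec \<^bold>= Lam (Lam (Lam (Lam ?b4)))"
    by (rule eq_beta') (simp add: eval_nat_numeral)
  ultimately have "\<Gamma> \<turnstile> Rec \<cdot> g \<cdot> h \<cdot> x \<cdot> y \<^bold>= Lam (Lam (Lam (Lam ?b4))) \<cdot> g \<cdot> h \<cdot> x \<cdot> y"
    by (intro eq_fun) (rule eq_trans)
  moreover have "\<Gamma> \<turnstile> Lam (Lam (Lam (Lam ?b4))) \<cdot> g \<cdot> h \<cdot> x \<cdot> y \<^bold>= Lam (Lam (Lam ?b3)) \<cdot> h \<cdot> x \<cdot> y"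
    by (intro eq_fun eq_beta') (simp add: eval_nat_numeral)
  moreover have "\<Gamma> \<turnstile> Lam (Lam (Lam ?b3)) \<cdot> h \<cdot> x \<cdot> y \<^bold>= Lam (Lam ?b2) \<cdot> x \<cdot> y"
    by (intro eq_fun eq_beta') (simp add: eval_nat_numeral)
  moreover have "\<Gamma> \<turnstile> Lam (Lam ?b2) \<cdot> x \<cdot> y \<^bold>= Lam ?b1 \<cdot> y"
    by (intro eq_fun eq_beta') (simp add: eval_nat_numeral)
  moreover have "\<Gamma> \<turnstile> Lam ?b1 \<cdot> y \<^bold>=
      Cond \<cdot> (is_zero \<cdot> y) \<cdot> (g \<cdot> x) \<cdot> (h \<cdot> x \<cdot> (Pred \<cdot> y) \<cdot> (Rec \<cdot> g \<cdot> h \<cdot> x \<cdot> (Pred \<cdot> y)))"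
    by (rule eq_beta') (simp add: eval_nat_numeral)
  ultimately show ?thesis
    by (blast intro: eq_trans)
qed

lemma Rec_Zero: "\<Gamma> \<turnstile> Rec \<cdot> g \<cdot> h \<cdot> x \<cdot> Zero \<^bold>= g \<cdot> x"
  by (rule eq_trans[OF Rec_eq cond_true[OF is_zero_Zero]])

text \<open>After the \<open>Cond\<close> has taken its second branch, \<open>Pred_Succ\<close>
  rewrites both occurrences of the predecessor by congruence.\<close>

lemma Rec_Succ: "\<Gamma> \<turnstile> Rec \<cdot> g \<cdot> h \<cdot> x \<cdot> (Succ \<cdot> y) \<^bold>= h \<cdot> x \<cdot> y \<cdot> (Rec \<cdot> g \<cdot> h \<cdot> x \<cdot> y)"
  by (rule eq_trans[OF Rec_eq eq_trans[OF cond_false[OF not_is_zero_Succ]]])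
    (intro eq_app eq_refl Pred_Succ)

section \<open>Recursion equations of addition and multiplication\<close>

lemma plus_Zero: "\<Gamma> \<turnstile> s \<^bold>+ Zero \<^bold>= s"
  unfolding nat_plus_def by (rule eq_trans[OF Rec_Zero eq_beta']) simp

lemma times_Zero: "\<Gamma> \<turnstile> s \<^bold>* Zero \<^bold>= Zero"
  unfolding nat_times_def by (rule eq_trans[OF Rec_Zero eq_beta']) simp

lemma eq_beta3:
  assumes "subst 0 u (subst 1 (lift 0 t) (subst 2 (lift 0 (lift 0 s)) b)) = v"
  shows "\<Gamma> \<turnstile> Lam (Lam (Lam b)) \<cdot> s \<cdot> t \<cdot> u \<^bold>= v"
proof -
  let ?b2 = "subst 2 (lift 0 (lift 0 s)) b"
  let ?b1 = "subst 1 (lift 0 t) ?b2"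
  have "\<Gamma> \<turnstile> Lam (Lam (Lam b)) \<cdot> s \<cdot> t \<cdot> u \<^bold>= Lam (Lam ?b2) \<cdot> t \<cdot> u"
    by (intro eq_fun eq_beta') (simp add: eval_nat_numeral)
  moreover have "\<Gamma> \<turnstile> Lam (Lam ?b2) \<cdot> t \<cdot> u \<^bold>= Lam ?b1 \<cdot> u"
    by (intro eq_fun eq_beta') simp
  moreover have "\<Gamma> \<turnstile> Lam ?b1 \<cdot> u \<^bold>= v"
    using assms by (rule eq_beta')
  ultimately show ?thesis
    by (blast intro: eq_trans)
qed

lemma plus_Succ: "\<Gamma> \<turnstile> s \<^bold>+ (Succ \<cdot> t) \<^bold>= Succ \<cdot> (s \<^bold>+ t)"
  unfolding nat_plus_def by (rule eq_trans[OF Rec_Succ eq_beta3]) simp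

lemma times_Succ: "\<Gamma> \<turnstile> s \<^bold>* (Succ \<cdot> t) \<^bold>= s \<^bold>+ s \<^bold>* t"
  unfolding nat_times_def by (rule eq_trans[OF Rec_Succ eq_beta3]) simp

section \<open>Typing of predecessor, addition and multiplication\<close>

text \<open>Neither \<open>Cond\<close> nor \<open>Destr\<close> has a typing rule, so the type is
  read off from the values at \<open>Zero\<close> and at successors, with induction providing the
  case distinction.\<close>

lemma Pred_type:
  assumes "\<Gamma> \<turnstile> t \<^bold>: NatT"
  shows "\<Gamma> \<turnstile> Pred \<cdot> t \<^bold>: NatT"
proof -
  have "\<Gamma> \<turnstile> all NatT (Pred \<cdot> Var 0 \<^bold>: NatT)"
  proof (rule nat_induction)
    show "\<Gamma> \<turnstile> subst 0 Zero (Pred \<cdot> Var 0 \<^bold>: NatT)"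
      by (simp add: type_cong[OF Zero_type Pred_Zero])
    show "insert (Pred \<cdot> Var 0 \<^bold>: NatT) (extend NatT \<Gamma>)
        \<turnstile> subst 0 (Succ \<cdot> Var 0) (lift 1 (Pred \<cdot> Var 0 \<^bold>: NatT))"
      by (simp, rule type_cong[OF hyp Pred_Succ], simp_all)
  qed
  then show ?thesis
    using assms by (rule all_inst) simp
qed

text \<open>Induction follows the recursion on the second summand. The claim is proved for two bound
  variables, the first summand being \<open>Var 1\<close>, and then instantiated with
  \<open>s\<close> and \<open>t\<close>.\<close>

lemma plus_type:
  assumes "\<Gamma> \<turnstile> s \<^bold>: NatT" "\<Gamma> \<turnstile> t \<^bold>: NatT"
  shows "\<Gamma> \<turnstile> s \<^bold>+ t \<^bold>: NatT"
proof -
  have "\<Gamma> \<turnstile> all NatT (all NatT (Var 1 \<^bold>+ Var 0 \<^bold>: NatT))"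
  proof (rule all_i[OF NatT_type], rule nat_induction)
    show "extend NatT \<Gamma> \<turnstile> subst 0 Zero (Var 1 \<^bold>+ Var 0 \<^bold>: NatT)"
      by (simp, rule type_cong[OF hyp plus_Zero], simp_all)
    show "insert (Var 1 \<^bold>+ Var 0 \<^bold>: NatT) (extend NatT (extend NatT \<Gamma>))
        \<turnstile> subst 0 (Succ \<cdot> Var 0) (lift 1 (Var 1 \<^bold>+ Var 0 \<^bold>: NatT))"
      by (simp, rule type_cong[OF Succ_type[OF hyp] plus_Succ], simp_all)
  qed
  then show ?thesis
    using assms by (rule nat_all_inst2) simp
qed

lemma times_type:
  assumes "\<Gamma> \<turnstile> s \<^bold>: NatT" "\<Gamma> \<turnstile> t \<^bold>: NatT"
  shows "\<Gamma> \<turnstile> s \<^bold>* t \<^bold>: NatT"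
proof -
  have "\<Gamma> \<turnstile> all NatT (all NatT (Var 1 \<^bold>* Var 0 \<^bold>: NatT))"
  proof (rule all_i[OF NatT_type], rule nat_induction)
    show "extend NatT \<Gamma> \<turnstile> subst 0 Zero (Var 1 \<^bold>* Var 0 \<^bold>: NatT)"
      by (simp add: type_cong[OF Zero_type times_Zero])
    show "insert (Var 1 \<^bold>* Var 0 \<^bold>: NatT) (extend NatT (extend NatT \<Gamma>))
        \<turnstile> subst 0 (Succ \<cdot> Var 0) (lift 1 (Var 1 \<^bold>* Var 0 \<^bold>: NatT))"
      by (simp, rule type_cong[OF plus_type[OF hyp hyp] times_Succ], simp_all)
  qed
  then show ?thesis
    using assms by (rule nat_all_inst2) simp
qed

section \<open>Commutativity of addition\<close>

text \<open>The mirror image of \<open>plus_Zero\<close>. Recursion inspects only the second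
  summand, so this side takes an induction and thus a typed \<open>t\<close>.\<close>

lemma Zero_plus:
  assumes "\<Gamma> \<turnstile> t \<^bold>: NatT"
  shows "\<Gamma> \<turnstile> Zero \<^bold>+ t \<^bold>= t"
proof -
  have "\<Gamma> \<turnstile> all NatT (Zero \<^bold>+ Var 0 \<^bold>= Var 0)"
  proof (rule nat_induction)
    show "\<Gamma> \<turnstile> subst 0 Zero (Zero \<^bold>+ Var 0 \<^bold>= Var 0)"
      by (simp add: plus_Zero)
    show "insert (Zero \<^bold>+ Var 0 \<^bold>= Var 0) (extend NatT \<Gamma>)
        \<turnstile> subst 0 (Succ \<cdot> Var 0) (lift 1 (Zero \<^bold>+ Var 0 \<^bold>= Var 0))"
      by (simp, rule eq_trans[OF plus_Succ eq_arg[OF hyp]], simp_all)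
  qed
  then show ?thesis
    using assms by (rule all_inst) simp
qed

lemma Succ_plus:
  assumes "\<Gamma> \<turnstile> s \<^bold>: NatT" "\<Gamma> \<turnstile> t \<^bold>: NatT"
  shows "\<Gamma> \<turnstile> (Succ \<cdot> s) \<^bold>+ t \<^bold>= Succ \<cdot> (s \<^bold>+ t)"
proof -
  let ?\<phi> = "(Succ \<cdot> Var 1) \<^bold>+ Var 0 \<^bold>= Succ \<cdot> (Var 1 \<^bold>+ Var 0)"
  have "\<Gamma> \<turnstile> all NatT (all NatT ?\<phi>)"
  proof (rule all_i[OF NatT_type], rule nat_induction)
    show "extend NatT \<Gamma> \<turnstile> subst 0 Zero ?\<phi>"
      by (simp add: eq_trans[OF plus_Zero eq_sym[OF eq_arg[OF plus_Zero]]])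
    let ?\<Delta> = "insert ?\<phi> (extend NatT (extend NatT \<Gamma>))"
    have "?\<Delta> \<turnstile> (Succ \<cdot> Var 1) \<^bold>+ (Succ \<cdot> Var 0) \<^bold>= Succ \<cdot> (Succ \<cdot> (Var 1 \<^bold>+ Var 0))"
      by (rule eq_trans[OF plus_Succ eq_arg[OF hyp]]) simp
    moreover have "?\<Delta> \<turnstile> Succ \<cdot> (Succ \<cdot> (Var 1 \<^bold>+ Var 0)) \<^bold>= Succ \<cdot> (Var 1 \<^bold>+ (Succ \<cdot> Var 0))"
      by (rule eq_sym[OF eq_arg[OF plus_Succ]])
    ultimately have "?\<Delta> \<turnstile> (Succ \<cdot> Var 1) \<^bold>+ (Succ \<cdot> Var 0) \<^bold>= Succ \<cdot> (Var 1 \<^bold>+ (Succ \<cdot> Var 0))"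
      by (rule eq_trans)
    then show "?\<Delta> \<turnstile> subst 0 (Succ \<cdot> Var 0) (lift 1 ?\<phi>)"
      by simp
  qed
  then show ?thesis
    using assms by (rule nat_all_inst2) simp
qed

text \<open>The base case joins \<open>plus_Zero\<close> with \<open>Zero_plus\<close>. In the step,
  \<open>plus_Succ\<close> with the induction hypothesis and \<open>Succ_plus\<close> bring the two
  sides to the same successor.\<close>

lemma plus_commute:
  assumes "\<Gamma> \<turnstile> s \<^bold>: NatT" "\<Gamma> \<turnstile> t \<^bold>: NatT"
  shows "\<Gamma> \<turnstile> s \<^bold>+ t \<^bold>= t \<^bold>+ s"
proof -
  let ?\<phi> = "Var 1 \<^bold>+ Var 0 \<^bold>= Var 0 \<^bold>+ Var 1"
  have "\<Gamma> \<turnstile> all NatT (all NatT ?\<phi>)"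
  proof (rule all_i[OF NatT_type], rule nat_induction)
    show "extend NatT \<Gamma> \<turnstile> subst 0 Zero ?\<phi>"
      by (simp, rule eq_trans[OF plus_Zero eq_sym[OF Zero_plus[OF hyp]]], simp_all)
    let ?\<Delta> = "insert ?\<phi> (extend NatT (extend NatT \<Gamma>))"
    have "?\<Delta> \<turnstile> Var 1 \<^bold>+ (Succ \<cdot> Var 0) \<^bold>= Succ \<cdot> (Var 0 \<^bold>+ Var 1)"
      by (rule eq_trans[OF plus_Succ eq_arg[OF hyp]]) simp
    moreover have "?\<Delta> \<turnstile> (Succ \<cdot> Var 0) \<^bold>+ Var 1 \<^bold>= Succ \<cdot> (Var 0 \<^bold>+ Var 1)"
      by (rule Succ_plus; rule hyp) simp_all
    ultimately have "?\<Delta> \<turnstile> Var 1 \<^bold>+ (Succ \<cdot> Var 0) \<^bold>= (Succ \<cdot> Var 0) \<^bold>+ Var 1"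
      by (blast intro: eq_trans eq_sym)
    then show "?\<Delta> \<turnstile> subst 0 (Succ \<cdot> Var 0) (lift 1 ?\<phi>)"
      by simp
  qed
  then show ?thesis
    using assms by (rule nat_all_inst2) simp
qed

section \<open>Leibniz equality\<close>

text \<open>The type of \<open>s\<close> makes the predicate at \<open>s\<close> a proposition, as
  implication introduction demands. The conclusion then follows by congruence and
  \<open>eq_mp\<close>.\<close>

lemma leibniz_i:
  assumes "\<Gamma> \<turnstile> s \<^bold>: NatT" "\<Gamma> \<turnstile> s \<^bold>= t"
  shows "\<Gamma> \<turnstile> s \<^bold>=\<^bsub>NatT\<^esub> t"
  unfolding leibniz_def
proof (rule all_i[OF NatT_pred_type], rule imp_i)
  let ?\<Delta> = "extend (NatT \<^bold>\<rightarrow> Prop) \<Gamma>"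
  show "?\<Delta> \<turnstile> Var 0 \<cdot> lift 0 s \<^bold>: Prop"
    using extend_lift[OF assms(1), where \<alpha> = "NatT \<^bold>\<rightarrow> Prop"]
    by (intro fun_e[OF hyp, where \<alpha> = NatT]) simp_all
  have "?\<Delta> \<turnstile> lift 0 s \<^bold>= lift 0 t"
    using extend_lift[OF assms(2), where \<alpha> = "NatT \<^bold>\<rightarrow> Prop"] by simp
  then have "insert (Var 0 \<cdot> lift 0 s) ?\<Delta> \<turnstile> Var 0 \<cdot> lift 0 s \<^bold>= Var 0 \<cdot> lift 0 t"
    by (rule weakening[OF eq_arg]) blast
  then show "insert (Var 0 \<cdot> lift 0 s) ?\<Delta> \<turnstile> Var 0 \<cdot> lift 0 t"
    by (rule eq_mp[OF hyp, rotated]) simp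
qed

lemma leibniz_e:
  assumes "\<Gamma> \<turnstile> s \<^bold>=\<^bsub>NatT\<^esub> t" "\<Gamma> \<turnstile> q \<^bold>: NatT \<^bold>\<rightarrow> Prop" "\<Gamma> \<turnstile> q \<cdot> s"
  shows "\<Gamma> \<turnstile> q \<cdot> t"
proof -
  have "\<Gamma> \<turnstile> q \<cdot> s \<^bold>\<supset> q \<cdot> t"
    using assms(1,2) unfolding leibniz_def by (rule all_inst) simp
  then show ?thesis
    using assms(3) by (rule imp_e)
qed

text \<open>Provides the typing premise of implication introduction when an equation between numbers
  is assumed.\<close>

lemma leibniz_prop:
  assumes "\<Gamma> \<turnstile> s \<^bold>: NatT" "\<Gamma> \<turnstile> t \<^bold>: NatT"
  shows "\<Gamma> \<turnstile> (s \<^bold>=\<^bsub>NatT\<^esub> t) \<^bold>: Prop"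
  unfolding leibniz_def
proof (rule all_t[OF NatT_pred_type], rule imp_t)
  let ?\<Delta> = "extend (NatT \<^bold>\<rightarrow> Prop) \<Gamma>"
  have p: "?\<Delta> \<turnstile> Var 0 \<^bold>: NatT \<^bold>\<rightarrow> Prop"
    by (rule hyp) simp
  show "?\<Delta> \<turnstile> Var 0 \<cdot> lift 0 s \<^bold>: Prop"
    using extend_lift[OF assms(1), where \<alpha> = "NatT \<^bold>\<rightarrow> Prop"] by (intro fun_e[OF p]) simp
  show "?\<Delta> \<turnstile> Var 0 \<cdot> lift 0 t \<^bold>: Prop"
    using extend_lift[OF assms(2), where \<alpha> = "NatT \<^bold>\<rightarrow> Prop"] by (intro fun_e[OF p]) simp
qed

section \<open>Injectivity of the successor and its difference from zero\<close>

lemma Succ_inject: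
  assumes s: "\<Gamma> \<turnstile> s \<^bold>: NatT" and eq: "\<Gamma> \<turnstile> Succ \<cdot> s \<^bold>=\<^bsub>NatT\<^esub> Succ \<cdot> t"
  shows "\<Gamma> \<turnstile> s \<^bold>=\<^bsub>NatT\<^esub> t"
  unfolding leibniz_def
proof (rule all_i[OF NatT_pred_type], rule imp_i)
  let ?\<Delta> = "extend (NatT \<^bold>\<rightarrow> Prop) \<Gamma>"
  let ?\<Delta>' = "insert (Var 0 \<cdot> lift 0 s) ?\<Delta>"
  \<comment> \<open>\<open>Var 1\<close> is the predicate quantified in the goal, seen through the
    binder of \<open>?q\<close>. On a successor, \<open>?q\<close> evaluates it at the
    predecessor.\<close>
  let ?q = "Lam (Var 1 \<cdot> (Pred \<cdot> Var 0))"
  show "?\<Delta> \<turnstile> Var 0 \<cdot> lift 0 s \<^bold>: Prop"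
    using extend_lift[OF s, where \<alpha> = "NatT \<^bold>\<rightarrow> Prop"] by (intro fun_e[OF hyp, where \<alpha> = NatT]) simp_all
  have q_Succ: "?\<Delta>' \<turnstile> ?q \<cdot> (Succ \<cdot> u) \<^bold>= Var 0 \<cdot> u" for u
    by (rule eq_trans[OF eq_beta' eq_arg[OF Pred_Succ]]) simp
  \<comment> \<open>\<open>Pred_type\<close> is what makes \<open>?q\<close> an admissible instance
    of the assumed Leibniz equality.\<close>
  have q_type: "?\<Delta>' \<turnstile> ?q \<^bold>: NatT \<^bold>\<rightarrow> Prop"
    by (rule fun_i[OF NatT_type], rule fun_e[OF hyp Pred_type[OF hyp]]) simp_all
  have "?\<Delta> \<turnstile> Succ \<cdot> lift 0 s \<^bold>=\<^bsub>NatT\<^esub> Succ \<cdot> lift 0 t"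
    using extend_lift[OF eq, where \<alpha> = "NatT \<^bold>\<rightarrow> Prop"] by simp
  then have eq': "?\<Delta>' \<turnstile> Succ \<cdot> lift 0 s \<^bold>=\<^bsub>NatT\<^esub> Succ \<cdot> lift 0 t"
    by (rule weakening) blast
  have "?\<Delta>' \<turnstile> ?q \<cdot> (Succ \<cdot> lift 0 s)"
    by (rule eq_mp_sym[OF hyp q_Succ]) simp
  then have "?\<Delta>' \<turnstile> ?q \<cdot> (Succ \<cdot> lift 0 t)"
    by (rule leibniz_e[OF eq' q_type])
  then show "?\<Delta>' \<turnstile> Var 0 \<cdot> lift 0 t"
    using q_Succ by (rule eq_mp)
qed

lemma Succ_not_Zero:
  assumes eq: "\<Gamma> \<turnstile> Succ \<cdot> s \<^bold>=\<^bsub>NatT\<^esub> Zero"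
  shows "\<Gamma> \<turnstile> Bot"
proof -
  \<comment> \<open>As a predicate, \<open>?c\<close> is false at \<open>Zero\<close> and true at
    every successor, so transporting it along the equation yields \<open>Bot\<close>.\<close>
  let ?c = "Cond \<cdot> (is_zero \<cdot> Var 0) \<cdot> Bot \<cdot> (\<^bold>\<not> Bot)"
  have zero: "\<Delta> \<turnstile> Cond \<cdot> (is_zero \<cdot> Zero) \<cdot> Bot \<cdot> (\<^bold>\<not> Bot) \<^bold>= Bot" for \<Delta> :: "'a trm set"
    by (rule cond_true[OF is_zero_Zero])
  have succ: "\<Delta> \<turnstile> Cond \<cdot> (is_zero \<cdot> (Succ \<cdot> u)) \<cdot> Bot \<cdot> (\<^bold>\<not> Bot) \<^bold>= (\<^bold>\<not> Bot)"
    for \<Delta> and u :: "'a trm"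
    by (rule cond_false[OF not_is_zero_Succ])
  \<comment> \<open>In each case of the induction \<open>?c\<close> equals one of two typed
    propositions, which gives it a type.\<close>
  have "\<Delta> \<turnstile> all NatT (?c \<^bold>: Prop)" for \<Delta> :: "'a trm set"
  proof (rule nat_induction)
    show "\<Delta> \<turnstile> subst 0 Zero (?c \<^bold>: Prop)"
      using type_cong[OF bot_prop zero] by simp
    show "insert (?c \<^bold>: Prop) (extend NatT \<Delta>) \<turnstile> subst 0 (Succ \<cdot> Var 0) (lift 1 (?c \<^bold>: Prop))"
      using type_cong[OF not_bot_prop succ] by simp
  qed
  \<comment> \<open>Instantiation with the fresh variable of the extended context yields the premise
    of \<open>fun_i\<close>.\<close>
  then have "extend NatT \<Gamma> \<turnstile> ?c \<^bold>: Prop"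
    by (rule all_inst[where t = "Var 0"]) (auto intro: hyp)
  then have q_type: "\<Gamma> \<turnstile> Lam ?c \<^bold>: NatT \<^bold>\<rightarrow> Prop"
    by (intro fun_i[OF NatT_type]) simp
  have "\<Gamma> \<turnstile> Lam ?c \<cdot> (Succ \<cdot> s)"
    by (rule eq_mp_sym[OF not_bot eq_trans[OF eq_beta' succ]]) simp
  then have "\<Gamma> \<turnstile> Lam ?c \<cdot> Zero"
    by (rule leibniz_e[OF eq q_type])
  then show ?thesis
    by (rule eq_mp[OF _ eq_trans[OF eq_beta' zero]]) simp
qed

section \<open>The six arithmetic formulas\<close>

theorem theorem1:
  shows "(({} :: 'c trm set) \<turnstile>
      all NatT (all NatT (Succ \<cdot> Var 1 \<^bold>=\<^bsub>NatT\<^esub> Succ \<cdot> Var 0 \<^bold>\<supset> Var 1 \<^bold>=\<^bsub>NatT\<^esub> Var 0)))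
    \<and> (({} :: 'c trm set) \<turnstile> all NatT (\<^bold>\<not> (Succ \<cdot> Var 0 \<^bold>=\<^bsub>NatT\<^esub> Zero)))
    \<and> (({} :: 'c trm set) \<turnstile> all NatT (Var 0 \<^bold>+ Zero \<^bold>=\<^bsub>NatT\<^esub> Var 0))
    \<and> (({} :: 'c trm set) \<turnstile>
      all NatT (all NatT (Var 1 \<^bold>+ Succ \<cdot> Var 0 \<^bold>=\<^bsub>NatT\<^esub> Succ \<cdot> (Var 1 \<^bold>+ Var 0))))
    \<and> (({} :: 'c trm set) \<turnstile> all NatT (Var 0 \<^bold>* Zero \<^bold>=\<^bsub>NatT\<^esub> Zero))
    \<and> (({} :: 'c trm set) \<turnstile>
      all NatT (all NatT (Var 1 \<^bold>* (Succ \<cdot> Var 0) \<^bold>=\<^bsub>NatT\<^esub> (Var 1 \<^bold>* Var 0) \<^bold>+ Var 1)))"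
proof (intro conjI)
  \<comment> \<open>\<open>?X\<close> declares one number and \<open>?XY\<close> two; the outer one
    is \<open>Var 1\<close> in \<open>?XY\<close>.\<close>
  let ?X = "extend NatT {} :: 'c trm set"
  let ?XY = "extend NatT ?X"
  have x: "?X \<turnstile> Var 0 \<^bold>: NatT" and x': "?XY \<turnstile> Var 1 \<^bold>: NatT" and y: "?XY \<turnstile> Var 0 \<^bold>: NatT"
    by (rule hyp; simp)+
  note all2_i = all_i[OF NatT_type all_i[OF NatT_type]]
  show "({} :: 'c trm set) \<turnstile> all NatT (all NatT (Succ \<cdot> Var 1 \<^bold>=\<^bsub>NatT\<^esub> Succ \<cdot> Var 0 \<^bold>\<supset> Var 1 \<^bold>=\<^bsub>NatT\<^esub> Var 0))"
  proof (rule all2_i, rule imp_i)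
    let ?e = "Succ \<cdot> Var 1 \<^bold>=\<^bsub>NatT\<^esub> Succ \<cdot> Var 0"
    show "?XY \<turnstile> ?e \<^bold>: Prop"
      by (intro leibniz_prop Succ_type x' y)
    show "insert ?e ?XY \<turnstile> Var 1 \<^bold>=\<^bsub>NatT\<^esub> Var 0"
      by (rule Succ_inject[OF weakening[OF x'] hyp]) auto
  qed
  show "({} :: 'c trm set) \<turnstile> all NatT (\<^bold>\<not> (Succ \<cdot> Var 0 \<^bold>=\<^bsub>NatT\<^esub> Zero))"
    unfolding neg_def
  proof (rule all_i[OF NatT_type], rule imp_i)
    let ?e = "Succ \<cdot> Var 0 \<^bold>=\<^bsub>NatT\<^esub> Zero"
    show "?X \<turnstile> ?e \<^bold>: Prop"
      by (intro leibniz_prop Succ_type Zero_type x)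
    show "insert ?e ?X \<turnstile> Bot"
      by (rule Succ_not_Zero[where s = "Var 0", OF hyp]) simp
  qed
  show "({} :: 'c trm set) \<turnstile> all NatT (Var 0 \<^bold>+ Zero \<^bold>=\<^bsub>NatT\<^esub> Var 0)"
    by (rule all_i[OF NatT_type], rule leibniz_i[OF plus_type[OF x Zero_type] plus_Zero])
  show "({} :: 'c trm set) \<turnstile> all NatT (all NatT (Var 1 \<^bold>+ Succ \<cdot> Var 0 \<^bold>=\<^bsub>NatT\<^esub> Succ \<cdot> (Var 1 \<^bold>+ Var 0)))"
    by (rule all2_i, rule leibniz_i[OF plus_type[OF x' Succ_type[OF y]] plus_Succ])
  show "({} :: 'c trm set) \<turnstile> all NatT (Var 0 \<^bold>* Zero \<^bold>=\<^bsub>NatT\<^esub> Zero)"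
    by (rule all_i[OF NatT_type], rule leibniz_i[OF times_type[OF x Zero_type] times_Zero])
  \<comment> \<open>The recursor puts the new summand on the left; commutativity, applied to the
    typed product, moves it to the right.\<close>
  have "?XY \<turnstile> Var 1 \<^bold>* (Succ \<cdot> Var 0) \<^bold>= Var 1 \<^bold>* Var 0 \<^bold>+ Var 1"
    by (rule eq_trans[OF times_Succ plus_commute[OF x' times_type[OF x' y]]])
  then show "({} :: 'c trm set) \<turnstile> all NatT (all NatT
      (Var 1 \<^bold>* (Succ \<cdot> Var 0) \<^bold>=\<^bsub>NatT\<^esub> (Var 1 \<^bold>* Var 0) \<^bold>+ Var 1))"
    by (intro all2_i leibniz_i times_type[OF x' Succ_type[OF y]])
qed

end
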